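(* For every positive integer $n$: (a) $M_2(S_n\times S_n)\ge (n-1)!$; (b) $M_{2,n}(S_n\times S_n)\ge n!$; (c) $M_2(A_n\times A_n)\ge (n-1)!/2$; (d) $M_{2,n}(A_n\times A_n)\ge n!/2$.
   Context: For a group $\Gamma$ and positive integers $k,g$, a set $A\subseteq\Gamma$ is an $S_k[g]$-set if for every $\mu\in\Gamma$ there are at most $g$ words $(\alpha_1,\ldots,\alpha_k)\in A^k$ with $\alpha_1\cdots\alpha_k=\mu$; an $S_k$-set is an $S_k[1]$-set. $M_{k,g}(\Gamma)$ is the maximum size of an $S_k[g]$-set in $\Gamma$, and $M_k(\Gamma)=M_{k,1}(\Gamma)$. $S_n$ and $A_n$ are the symmetric and alternating groups on $n$ letters. *)

theory Defs
  imports Complex_Main "HOL-Algebra.Sym_Groups"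
begin

definition word_prod :: "('a, 'b) monoid_scheme \<Rightarrow> 'a list \<Rightarrow> 'a" where
  "word_prod G w = foldr (mult G) w (one G)"

text \<open>
  Finiteness of the set of words is demanded explicitly, because the cardinality of an
  infinite set is 0 in HOL.
\<close>

definition S_set :: "('a, 'b) monoid_scheme \<Rightarrow> nat \<Rightarrow> nat \<Rightarrow> 'a set \<Rightarrow> bool" where
  "S_set G k g A \<longleftrightarrow>
     A \<subseteq> carrier G \<and>
     (\<forall>\<mu> \<in> carrier G.
        finite {w. length w = k \<and> set w \<subseteq> A \<and> word_prod G w = \<mu>} \<and>
        card {w. length w = k \<and> set w \<subseteq> A \<and> word_prod G w = \<mu>} \<le> g)"

text \<open>
  The maximum is taken as a natural number, so it is meaningful only for groups with
  finite carrier (where the set below is finite, and non-empty since the empty set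
  qualifies for positive \<open>k\<close>).
\<close>

definition max_S_set_size :: "nat \<Rightarrow> nat \<Rightarrow> ('a, 'b) monoid_scheme \<Rightarrow> nat" where
  "max_S_set_size k g G = Max {card A |A. S_set G k g A}"

abbreviation max_S1_set_size :: "nat \<Rightarrow> ('a, 'b) monoid_scheme \<Rightarrow> nat" where
  "max_S1_set_size k G \<equiv> max_S_set_size k 1 G"

end

theory Submission
  imports Defs "HOL-Algebra.Group_Action"
begin

text \<open>
  Fix \<open>c\<close> in a finite group \<open>G\<close> and consider the pairs \<open>(x, x c)\<close> with \<open>x\<close> in a subset \<open>B\<close> of \<open>G\<close>.
  If \<open>x y = \<mu>\<close> and \<open>x c y c = \<nu>\<close>, then \<open>x c x\<^sup>-\<^sup>1 = \<nu> c\<^sup>-\<^sup>1 \<mu>\<^sup>-\<^sup>1\<close>: a word is determined by its first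
  letter, and that letter lies in a fixed fibre of \<open>x \<mapsto> x c x\<^sup>-\<^sup>1\<close>. A set \<open>B\<close> of representatives of
  the fibres gives an \<open>S\<^sub>2\<close>-set as large as the conjugacy class of \<open>c\<close>, and \<open>B = G\<close> gives an
  \<open>S\<^sub>2[g]\<close>-set, where \<open>g\<close> is the order of the centralizer of \<open>c\<close>.

  Take for \<open>c\<close> the cycle \<open>(1 2 \<dots> m)\<close> with \<open>m\<close> the odd one of \<open>n\<close> and \<open>n - 1\<close>. It is an even
  permutation, and a permutation of \<open>{1..n}\<close> commuting with it is determined by its value at 1.
  So its centralizer in either group has at most \<open>n\<close> elements, and its conjugacy class has at
  least \<open>1/n\<close> times as many elements as the group.
\<close>

section \<open>\<open>S\<^sub>2[g]\<close>-sets from conjugation\<close>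

lemma card_le_max_S_set_size:
  assumes "finite (carrier G)" and "S_set G k g A"
  shows "card A \<le> max_S_set_size k g G"
proof -
  have "{card A |A. S_set G k g A} \<subseteq> card ` Pow (carrier G)"
    by (auto simp: S_set_def)
  then have "finite {card A |A. S_set G k g A}"
    using assms(1) finite_subset by fastforce
  with assms(2) show ?thesis
    unfolding max_S_set_size_def by (intro Max_ge) auto
qed

context group
begin

lemma S_set_2_iff:
  assumes A: "A \<subseteq> carrier G" and fin: "finite A"
  shows "S_set G 2 g A \<longleftrightarrow> (\<forall>\<mu>\<in>carrier G. card {a \<in> A. inv a \<otimes> \<mu> \<in> A} \<le> g)"
proof -
  have words: "{w. length w = 2 \<and> set w \<subseteq> A \<and> word_prod G w = \<mu>}
      = (\<lambda>a. [a, inv a \<otimes> \<mu>]) ` {a \<in> A. inv a \<otimes> \<mu> \<in> A}" (is "?W = ?F ` ?L")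
    if \<mu>: "\<mu> \<in> carrier G" for \<mu>
  proof (intro equalityI subsetI)
    fix w assume w: "w \<in> ?W"
    then obtain a b where ab: "w = [a, b]"
      by (auto simp: numeral_2_eq_2 length_Suc_conv)
    then have in_A: "a \<in> A" "b \<in> A" and "a \<otimes> b = \<mu>"
      using w A by (auto simp: word_prod_def)
    then have "b = inv a \<otimes> \<mu>"
      using A \<mu> by (simp add: inv_solve_left subset_iff)
    then show "w \<in> ?F ` ?L"
      using ab in_A by auto
  next
    fix w assume "w \<in> ?F ` ?L"
    then show "w \<in> ?W"
      using A \<mu> by (auto simp: word_prod_def m_assoc[symmetric])
  qed
  have "inj_on (\<lambda>a. [a, inv a \<otimes> \<mu>]) L" for \<mu> L
    by (rule inj_onI) simp
  then show ?thesis
    using A fin by (simp add: S_set_def words card_image)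
qed

lemma conj_eq_word_quotient:
  assumes "x \<in> carrier G" "y \<in> carrier G" "c \<in> carrier G"
  shows "x \<otimes> c \<otimes> inv x = (x \<otimes> c) \<otimes> (y \<otimes> c) \<otimes> inv c \<otimes> inv (x \<otimes> y)"
  using assms by (simp add: m_assoc inv_mult_group) (simp flip: m_assoc)

lemma S_set_translation_graph:
  assumes fin: "finite B" and c: "c \<in> carrier G" and B: "B \<subseteq> carrier G"
    and fibres: "\<And>d. d \<in> carrier G \<Longrightarrow> card {x \<in> B. x \<otimes> c \<otimes> inv x = d} \<le> g"
  shows "S_set (G \<times>\<times> G) 2 g ((\<lambda>x. (x, x \<otimes> c)) ` B)"
proof -
  let ?A = "(\<lambda>x. (x, x \<otimes> c)) ` B"
  interpret GG: group "G \<times>\<times> G"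
    by (rule DirProd_group) (rule is_group)+
  have "card {a \<in> ?A. inv\<^bsub>G \<times>\<times> G\<^esub> a \<otimes>\<^bsub>G \<times>\<times> G\<^esub> \<mu> \<in> ?A} \<le> g"
    if \<mu>: "\<mu> \<in> carrier (G \<times>\<times> G)" for \<mu>
  proof -
    obtain \<mu>1 \<mu>2 where \<mu>12: "\<mu> = (\<mu>1, \<mu>2)" "\<mu>1 \<in> carrier G" "\<mu>2 \<in> carrier G"
      using \<mu> by auto
    let ?d = "\<mu>2 \<otimes> inv c \<otimes> inv \<mu>1"
    have conj: "x \<otimes> c \<otimes> inv x = ?d"
      if x: "x \<in> B" and y: "inv (x \<otimes> c) \<otimes> \<mu>2 = (inv x \<otimes> \<mu>1) \<otimes> c" for x
    proof -
      have x_carr: "x \<in> carrier G"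
        using x B by auto
      then have "\<mu>2 = (x \<otimes> c) \<otimes> ((inv x \<otimes> \<mu>1) \<otimes> c)" and "\<mu>1 = x \<otimes> (inv x \<otimes> \<mu>1)"
        using y c \<mu>12 by (simp_all add: inv_solve_left' m_assoc[symmetric])
      then show ?thesis
        using conj_eq_word_quotient[of x "inv x \<otimes> \<mu>1" c] x_carr c \<mu>12 by simp
    qed
    have "{a \<in> ?A. inv\<^bsub>G \<times>\<times> G\<^esub> a \<otimes>\<^bsub>G \<times>\<times> G\<^esub> \<mu> \<in> ?A}
        \<subseteq> (\<lambda>x. (x, x \<otimes> c)) ` {x \<in> B. x \<otimes> c \<otimes> inv x = ?d}"
      using B c \<mu>12(1)
      by (auto simp: inv_DirProd[OF is_group is_group] subset_iff intro!: imageI conj)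
    then have "card {a \<in> ?A. inv\<^bsub>G \<times>\<times> G\<^esub> a \<otimes>\<^bsub>G \<times>\<times> G\<^esub> \<mu> \<in> ?A}
        \<le> card {x \<in> B. x \<otimes> c \<otimes> inv x = ?d}"
      using fin by (intro surj_card_le) auto
    also have "\<dots> \<le> g"
      using fibres c \<mu>12 by simp
    finally show ?thesis .
  qed
  moreover have "?A \<subseteq> carrier (G \<times>\<times> G)"
    using B c by auto
  ultimately show ?thesis
    using fin by (simp add: GG.S_set_2_iff)
qed

lemma card_le_max_S_set_size_DirProd:
  assumes "finite (carrier G)" and "c \<in> carrier G" and "B \<subseteq> carrier G"
    and "\<And>d. d \<in> carrier G \<Longrightarrow> card {x \<in> B. x \<otimes> c \<otimes> inv x = d} \<le> g"
  shows "card B \<le> max_S_set_size 2 g (G \<times>\<times> G)"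
proof -
  have "card B = card ((\<lambda>x. (x, x \<otimes> c)) ` B)"
    by (simp add: card_image inj_on_def)
  also have "\<dots> \<le> max_S_set_size 2 g (G \<times>\<times> G)"
    using S_set_translation_graph[OF finite_subset[OF assms(3,1)] assms(2-4)] assms(1)
    by (intro card_le_max_S_set_size) simp_all
  finally show ?thesis .
qed

end

section \<open>Conjugacy classes and centralizers\<close>

definition conjugacy_class :: "('a, 'b) monoid_scheme \<Rightarrow> 'a \<Rightarrow> 'a set" where
  "conjugacy_class G c = (\<lambda>x. x \<otimes>\<^bsub>G\<^esub> c \<otimes>\<^bsub>G\<^esub> inv\<^bsub>G\<^esub> x) ` carrier G"

definition centralizer :: "('a, 'b) monoid_scheme \<Rightarrow> 'a \<Rightarrow> 'a set" where
  "centralizer G c = {z \<in> carrier G. c \<otimes>\<^bsub>G\<^esub> z = z \<otimes>\<^bsub>G\<^esub> c}"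

context group
begin

lemma conj_eq_iff_mem_centralizer:
  assumes carr: "c \<in> carrier G" "x \<in> carrier G" "y \<in> carrier G"
  shows "x \<otimes> c \<otimes> inv x = y \<otimes> c \<otimes> inv y \<longleftrightarrow> inv x \<otimes> y \<in> centralizer G c"
proof -
  have "x \<otimes> c \<otimes> inv x = y \<otimes> c \<otimes> inv y \<longleftrightarrow> x \<otimes> c \<otimes> inv x \<otimes> y = y \<otimes> c"
    using carr by (metis inv_closed inv_solve_right m_closed)
  also have "\<dots> \<longleftrightarrow> c \<otimes> (inv x \<otimes> y) = inv x \<otimes> y \<otimes> c"
    using carr by (auto simp: m_assoc inv_solve_left)
  finally show ?thesis
    using carr by (simp add: centralizer_def)
qed

lemma card_conj_fibre_le_card_centralizer:
  assumes fin: "finite (carrier G)" and c: "c \<in> carrier G"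
  shows "card {x \<in> carrier G. x \<otimes> c \<otimes> inv x = d} \<le> card (centralizer G c)"
proof (cases "{x \<in> carrier G. x \<otimes> c \<otimes> inv x = d} = {}")
  case False
  then obtain y where y: "y \<in> carrier G" "y \<otimes> c \<otimes> inv y = d"
    by auto
  show ?thesis
  proof (rule card_inj_on_le)
    show "inj_on (\<lambda>x. inv y \<otimes> x) {x \<in> carrier G. x \<otimes> c \<otimes> inv x = d}"
      using y by (intro inj_onI) auto
    show "(\<lambda>x. inv y \<otimes> x) ` {x \<in> carrier G. x \<otimes> c \<otimes> inv x = d} \<subseteq> centralizer G c"
      using y by (auto simp: conj_eq_iff_mem_centralizer[OF c y(1), symmetric])
    show "finite (centralizer G c)"
      using fin by (simp add: centralizer_def)
  qed
qed (simp only: card.empty zero_le)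

lemma card_conjugacy_class_times_card_centralizer:
  assumes c: "c \<in> carrier G"
  shows "card (conjugacy_class G c) * card (centralizer G c) = order G"
proof -
  let ?conj = "\<lambda>g. \<lambda>h\<in>carrier G. g \<otimes> h \<otimes> inv g"
  have "orbit G ?conj c = conjugacy_class G c"
    using c by (auto simp: orbit_def conjugacy_class_def)
  moreover have "stabilizer G ?conj c = centralizer G c"
    using c by (auto simp: stabilizer_def centralizer_def inv_solve_right')
  ultimately show ?thesis
    using group_action.orbit_stabilizer_theorem[OF action_by_conjugation c] by simp
qed

theorem card_conjugacy_class_le_max_S1_set_size:
  assumes fin: "finite (carrier G)" and c: "c \<in> carrier G"
  shows "card (conjugacy_class G c) \<le> max_S1_set_size 2 (G \<times>\<times> G)"
proof -
  have "conjugacy_class G c \<subseteq> (\<lambda>x. x \<otimes> c \<otimes> inv x) ` carrier G"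
    by (simp add: conjugacy_class_def)
  then obtain B where B: "B \<subseteq> carrier G" "inj_on (\<lambda>x. x \<otimes> c \<otimes> inv x) B"
    "conjugacy_class G c = (\<lambda>x. x \<otimes> c \<otimes> inv x) ` B"
    unfolding subset_image_inj by blast
  have "card {x \<in> B. x \<otimes> c \<otimes> inv x = d} \<le> 1" for d
    using B(2) finite_subset[OF B(1) fin] by (auto simp: card_le_Suc0_iff_eq inj_on_def)
  then show ?thesis
    using card_le_max_S_set_size_DirProd[OF fin c B(1)] B(2,3) by (simp add: card_image)
qed

theorem order_le_max_S_set_size:
  assumes "finite (carrier G)" and "c \<in> carrier G" and "card (centralizer G c) \<le> g"
  shows "order G \<le> max_S_set_size 2 g (G \<times>\<times> G)"
  unfolding order_def
proof (rule card_le_max_S_set_size_DirProd[OF assms(1,2) subset_refl])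
  show "card {x \<in> carrier G. x \<otimes> c \<otimes> inv x = d} \<le> g" for d
    using card_conj_fibre_le_card_centralizer[OF assms(1,2)] assms(3) by (rule order_trans)
qed

corollary order_le_mult_max_S1_set_size:
  assumes "finite (carrier G)" and "c \<in> carrier G" and "card (centralizer G c) \<le> g"
  shows "order G \<le> g * max_S1_set_size 2 (G \<times>\<times> G)"
proof -
  have "order G = card (centralizer G c) * card (conjugacy_class G c)"
    using card_conjugacy_class_times_card_centralizer[OF assms(2)]
    by (simp add: mult.commute)
  also have "\<dots> \<le> g * max_S1_set_size 2 (G \<times>\<times> G)"
    using assms card_conjugacy_class_le_max_S1_set_size by (intro mult_le_mono)
  finally show ?thesis .
qed

end

section \<open>Permutations commuting with a long cycle\<close>

lemma permutes_eqI_except_one: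
  assumes p: "p permutes S" and q: "q permutes S" and eq: "\<And>x. x \<in> S - {a} \<Longrightarrow> p x = q x"
  shows "p = q"
proof -
  have "(inv' q \<circ> p) x = x" if "x \<in> S - {a}" for x
    using eq[OF that] permutes_inverses(2)[OF q] by simp
  with permutes_compose[OF p permutes_inv[OF q]] have "inv' q \<circ> p permutes {a}"
    by (rule permutes_superset)
  then have "q \<circ> (inv' q \<circ> p) = q"
    by simp
  then show ?thesis
    using permutes_inv_o(1)[OF q] by (simp add: o_assoc)
qed

lemma funpow_commute_apply:
  assumes "c \<circ> z = z \<circ> c"
  shows "z ((c ^^ i) x) = (c ^^ i) (z x)"
proof -
  have "z (c y) = c (z y)" for y
    using fun_cong[OF assms, of y] by simp
  then show ?thesis
    by (induction i) simp_all
qed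

lemma card_commuting_permutations_le:
  assumes fin: "finite S" and p: "p \<in> S"
    and reach: "\<And>x. x \<in> S - {a} \<Longrightarrow> \<exists>i. x = (c ^^ i) p"
  shows "card {z. z permutes S \<and> c \<circ> z = z \<circ> c} \<le> card S"
proof (rule card_inj_on_le)
  show "inj_on (\<lambda>z. z p) {z. z permutes S \<and> c \<circ> z = z \<circ> c}"
  proof (rule inj_onI, clarify)
    fix y z
    assume y: "y permutes S" "c \<circ> y = y \<circ> c" and z: "z permutes S" "c \<circ> z = z \<circ> c" and "y p = z p"
    then have "y ((c ^^ i) p) = z ((c ^^ i) p)" for i
      by (simp add: funpow_commute_apply)
    with y(1) z(1) show "y = z"
      using reach by (intro permutes_eqI_except_one) auto
  qed
  show "(\<lambda>z. z p) ` {z. z permutes S \<and> c \<circ> z = z \<circ> c} \<subseteq> S"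
    using p by (auto simp: permutes_in_image)
qed (rule fin)

lemma funpow_cycle_of_list_hd:
  assumes "distinct cs" and "i < length cs"
  shows "(cycle_of_list cs ^^ i) (hd cs) = cs ! i"
proof -
  have "cs \<noteq> []"
    using assms(2) by auto
  then have "(cycle_of_list cs ^^ i) (hd cs) = map (cycle_of_list cs ^^ i) cs ! 0"
    by (simp add: hd_conv_nth)
  also have "\<dots> = rotate i cs ! 0"
    by (simp only: cyclic_rotation[OF assms(1)])
  finally show ?thesis
    using assms(2) \<open>cs \<noteq> []\<close> by (simp add: nth_rotate)
qed

lemma card_permutations_commuting_with_cycle_le:
  assumes cs: "distinct cs" "cs \<noteq> []" "set cs \<subseteq> S"
    and fin: "finite S" and card: "card S \<le> Suc (length cs)"
  shows "card {z. z permutes S \<and> cycle_of_list cs \<circ> z = z \<circ> cycle_of_list cs} \<le> card S"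
proof -
  have "card (S - set cs) \<le> Suc 0"
    using cs card by (simp add: card_Diff_subset distinct_card)
  then have "\<exists>a. S - set cs \<subseteq> {a}"
    using fin by (simp add: card_le_Suc0_iff_eq) blast
  then obtain a where a: "S - {a} \<subseteq> set cs"
    by auto
  have "\<exists>i. x = (cycle_of_list cs ^^ i) (hd cs)" if "x \<in> S - {a}" for x
  proof -
    obtain i where "i < length cs" "x = cs ! i"
      using \<open>x \<in> S - {a}\<close> a by (metis in_set_conv_nth subsetD)
    then show ?thesis
      using funpow_cycle_of_list_hd[OF cs(1)] by metis
  qed
  moreover have "hd cs \<in> S"
    using cs by auto
  ultimately show ?thesis
    using fin by (intro card_commuting_permutations_le)
qed

lemma evenperm_cycle_of_list:
  assumes "distinct cs" and "cs \<noteq> []"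
  shows "evenperm (cycle_of_list cs) \<longleftrightarrow> odd (length cs)"
  using assms
proof (induction cs rule: cycle_of_list.induct)
  case (1 i j cs)
  then show ?case
    by (simp add: evenperm_comp permutation_swap_id permutation_of_cycle evenperm_swap
        del: o_apply comp_apply)
qed simp_all

section \<open>Symmetric and alternating groups\<close>

lemma finite_carrier_sym_group: "finite (carrier (sym_group n))"
  by (simp add: sym_group_def finite_permutations)

lemma finite_carrier_alt_group: "finite (carrier (alt_group n))"
  using subgroup.subset[OF alt_group_is_subgroup] finite_carrier_sym_group by (rule finite_subset)

lemma order_sym_group: "order (sym_group n) = fact n"
  by (simp add: order_def sym_group_card_carrier)

lemma fact_le_2_mult_order_alt_group: "fact n \<le> 2 * order (alt_group n)"
proof (cases "n \<ge> 2")
  case True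
  then show ?thesis
    by (simp add: order_def alt_group_card_carrier)
next
  case False
  then have "n = 0 \<or> n = 1"
    by linarith
  then have "fact n = (1 :: nat)"
    by auto
  moreover have "0 < order (alt_group n)"
    using group.is_monoid[OF alt_group_is_group] finite_carrier_alt_group
    by (simp add: monoid.order_gt_0_iff_finite)
  ultimately show ?thesis
    by simp
qed

lemma even_permutation_small_centralizersE:
  assumes "n \<ge> 1"
  obtains c where "c \<in> carrier (sym_group n)" and "c \<in> carrier (alt_group n)"
    and "card (centralizer (sym_group n) c) \<le> n" and "card (centralizer (alt_group n) c) \<le> n"
proof -
  define m where "m = (if odd n then n else n - 1)"
  have m: "odd m" "m \<le> n" "n \<le> Suc m"
    using assms by (auto simp: m_def)
  define cs where "cs = [1..<Suc m]"
  have cs: "distinct cs" "cs \<noteq> []" "set cs \<subseteq> {1..n}" "length cs = m"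
    using m by (auto simp: cs_def Suc_le_eq odd_pos)
  have "cycle_of_list cs \<in> carrier (sym_group n)" and "cycle_of_list cs \<in> carrier (alt_group n)"
    using permutes_subset[OF cycle_permutes cs(3)] evenperm_cycle_of_list[OF cs(1,2)] cs(4) m(1)
    by (simp_all add: sym_group_carrier alt_group_carrier)
  moreover have sym: "card (centralizer (sym_group n) (cycle_of_list cs)) \<le> n"
    using card_permutations_commuting_with_cycle_le[OF cs(1-3)] cs(4) m(3)
    by (simp add: centralizer_def sym_group_carrier sym_group_mult)
  moreover have "centralizer (alt_group n) (cycle_of_list cs)
      \<subseteq> centralizer (sym_group n) (cycle_of_list cs)"
    using subgroup.subset[OF alt_group_is_subgroup]
    by (auto simp: centralizer_def sym_group_mult alt_group_mult)
  then have "card (centralizer (alt_group n) (cycle_of_list cs))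
      \<le> card (centralizer (sym_group n) (cycle_of_list cs))"
    using finite_carrier_sym_group by (intro card_mono) (simp_all add: centralizer_def)
  ultimately show thesis
    using that sym by (meson order_trans)
qed

lemma half_fact_le_iff: "fact m / 2 \<le> real k \<longleftrightarrow> fact m \<le> 2 * k"
proof -
  have "fact m / 2 \<le> real k \<longleftrightarrow> real (fact m) \<le> real (2 * k)"
    by (simp add: mult.commute)
  then show ?thesis
    by (simp only: of_nat_le_iff)
qed

theorem theorem1p8:
  fixes n :: nat
  assumes "n \<ge> 1"
  shows "max_S1_set_size 2 (sym_group n \<times>\<times> sym_group n) \<ge> fact (n - 1) \<and>
         max_S_set_size 2 n (sym_group n \<times>\<times> sym_group n) \<ge> fact n \<and>
         real (max_S1_set_size 2 (alt_group n \<times>\<times> alt_group n)) \<ge> fact (n - 1) / 2 \<and>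
         real (max_S_set_size 2 n (alt_group n \<times>\<times> alt_group n)) \<ge> fact n / 2"
proof -
  obtain c where c: "c \<in> carrier (sym_group n)" "c \<in> carrier (alt_group n)"
    "card (centralizer (sym_group n) c) \<le> n" "card (centralizer (alt_group n) c) \<le> n"
    using assms by (rule even_permutation_small_centralizersE)
  note sym = sym_group_is_group finite_carrier_sym_group c(1,3)
  note alt = alt_group_is_group finite_carrier_alt_group c(2,4)
  have fact_n: "fact n = n * (fact (n - 1) :: nat)"
    using assms by (simp add: fact_reduce)
  have "fact (n - 1) \<le> max_S1_set_size 2 (sym_group n \<times>\<times> sym_group n)"
    using group.order_le_mult_max_S1_set_size[OF sym] assms by (simp add: order_sym_group fact_n)
  moreover have "fact n \<le> max_S_set_size 2 n (sym_group n \<times>\<times> sym_group n)"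
    using group.order_le_max_S_set_size[OF sym] by (simp add: order_sym_group)
  moreover have "n * fact (n - 1) \<le> n * (2 * max_S1_set_size 2 (alt_group n \<times>\<times> alt_group n))"
    using group.order_le_mult_max_S1_set_size[OF alt] fact_le_2_mult_order_alt_group[of n]
    unfolding fact_n by linarith
  then have "fact (n - 1) \<le> 2 * max_S1_set_size 2 (alt_group n \<times>\<times> alt_group n)"
    using assms by simp
  moreover have "fact n \<le> 2 * max_S_set_size 2 n (alt_group n \<times>\<times> alt_group n)"
    using group.order_le_max_S_set_size[OF alt] fact_le_2_mult_order_alt_group[of n] by linarith
  ultimately show ?thesis
    by (simp only: half_fact_le_iff simp_thms)
qed

end
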